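(* Let $f$ be a rank-1 homeomorphism of a Polish space $X$ which has a non-repeating tower representation. If $g$ is a homeomorphism of $X$ that commutes with $f$, then there is some $i \in \mathbb{Z}$ such that $f^i = g$.
   Context: $\mathbb{N}=\{0,1,2,\dots\}$. A homeomorphism $f$ of a Polish space $X$ (i.e. $f:X\to X$) is rank-1 if there exist a strictly decreasing sequence $\{B_n\}_{n\in\mathbb{N}}$ of clopen subsets of $X$ and a strictly increasing sequence $\{h_n\}_{n\in\mathbb{N}}$ of positive integers such that, for all $n$: (1) the sets $B_n, f(B_n), \dots, f^{h_n-1}(B_n)$ are pairwise disjoint; (2) $\bigcup_{0\le i<h_n} f^i(B_n) \subseteq \bigcup_{0\le j<h_{n+1}} f^j(B_{n+1})$; (3) if $0\le j<h_{n+1}$, $0\le i<h_n$ and $f^j(B_{n+1})\cap f^i(B_n)\neq\emptyset$, then $f^j(B_{n+1})\subseteq f^i(B_n)$; (4) $f^{h_{n+1}-1}(B_{n+1})\subseteq f^{h_n-1}(B_n)$; and (5) with $L_n := X\setminus\bigcup_{0\le i<h_n} f^i(B_n)$, the sets $f^k(B_n)$ and $f^k(L_n)$ ($k\in\mathbb{Z}$, $n\in\mathbb{N}$) form a basis for the topology of $X$. Such a pair $(\{B_n\},\{h_n\})$ is called a tower representation of $f$. Define $W_n:\{0,\dots,h_n-1\}\to\{0,1\}$ by $W_n(i)=0$ iff $f^i(B_n)\subseteq f^j(B_0)$ for some $0\le j<h_0$. Each $W_n$ is an initial segment of $W_{n+1}$; let $W_\infty:\mathbb{N}\to\{0,1\}$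 be the common extension, so $W_\infty(i)=W_n(i)$ whenever $i<h_n$. The tower representation is called non-repeating if the sequence $W_\infty$ is not periodic, i.e. there is no $p\geq 1$ with $W_\infty(i+p)=W_\infty(i)$ for all $i\in\mathbb{N}$. *)

theory Defs
  imports "HOL-Analysis.Analysis"
begin

text \<open>A Polish space is a type of class \<open>polish_space\<close>; every notion below depends only on the
  topology, not on the metric of the class.\<close>

definition homeo :: "('a::topological_space \<Rightarrow> 'a) \<Rightarrow> bool" where
  "homeo f \<longleftrightarrow> homeomorphism UNIV UNIV f (inv f)"

text \<open>Integer iterates; the negative ones are meaningful for bijective \<open>f\<close> only.\<close>

definition zpow :: "('a \<Rightarrow> 'a) \<Rightarrow> int \<Rightarrow> 'a \<Rightarrow> 'a" where
  "zpow f k = (if 0 \<le> k then f ^^ nat k else inv f ^^ nat (- k))"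

definition tower :: "('a \<Rightarrow> 'a) \<Rightarrow> (nat \<Rightarrow> 'a set) \<Rightarrow> (nat \<Rightarrow> nat) \<Rightarrow> nat \<Rightarrow> 'a set" where
  "tower f B h n = (\<Union>i<h n. (f ^^ i) ` B n)"

definition leftover :: "('a \<Rightarrow> 'a) \<Rightarrow> (nat \<Rightarrow> 'a set) \<Rightarrow> (nat \<Rightarrow> nat) \<Rightarrow> nat \<Rightarrow> 'a set" where
  "leftover f B h n = - tower f B h n"

definition tower_rep ::
    "('a::topological_space \<Rightarrow> 'a) \<Rightarrow> (nat \<Rightarrow> 'a set) \<Rightarrow> (nat \<Rightarrow> nat) \<Rightarrow> bool" where
  "tower_rep f B h \<longleftrightarrow>
     (\<forall>m n. m < n \<longrightarrow> B n \<subset> B m) \<and>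
     (\<forall>n. open (B n) \<and> closed (B n)) \<and>
     strict_mono h \<and>
     (\<forall>n. 0 < h n) \<and>
     (\<forall>n. disjoint_family_on (\<lambda>i. (f ^^ i) ` B n) {..<h n}) \<and>
     (\<forall>n. tower f B h n \<subseteq> tower f B h (Suc n)) \<and>
     (\<forall>n j i. j < h (Suc n) \<longrightarrow> i < h n \<longrightarrow>
        (f ^^ j) ` B (Suc n) \<inter> (f ^^ i) ` B n \<noteq> {} \<longrightarrow>
        (f ^^ j) ` B (Suc n) \<subseteq> (f ^^ i) ` B n) \<and>
     (\<forall>n. (f ^^ (h (Suc n) - 1)) ` B (Suc n) \<subseteq> (f ^^ (h n - 1)) ` B n) \<and>
     topological_basis
       ({zpow f k ` B n | k n. True} \<union> {zpow f k ` leftover f B h n | k n. True})"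

definition rank_1 :: "('a::topological_space \<Rightarrow> 'a) \<Rightarrow> bool" where
  "rank_1 f \<longleftrightarrow> homeo f \<and> (\<exists>B h. tower_rep f B h)"

text \<open>The word \<open>W_n\<close>; only its values at \<open>i < h n\<close> are meaningful.\<close>

definition tower_word ::
    "('a \<Rightarrow> 'a) \<Rightarrow> (nat \<Rightarrow> 'a set) \<Rightarrow> (nat \<Rightarrow> nat) \<Rightarrow> nat \<Rightarrow> nat \<Rightarrow> nat" where
  "tower_word f B h n i = (if \<exists>j<h 0. (f ^^ i) ` B n \<subseteq> (f ^^ j) ` B 0 then 0 else 1)"

text \<open>The common extension \<open>W_\<infinity>\<close> reads position \<open>i\<close> in the first word that is long enough; lemma
  \<open>infinite_word_eq\<close> shows that every other long enough word gives the same value.\<close>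

definition infinite_word ::
    "('a \<Rightarrow> 'a) \<Rightarrow> (nat \<Rightarrow> 'a set) \<Rightarrow> (nat \<Rightarrow> nat) \<Rightarrow> nat \<Rightarrow> nat" where
  "infinite_word f B h i = tower_word f B h (LEAST n. i < h n) i"

definition non_repeating ::
    "('a \<Rightarrow> 'a) \<Rightarrow> (nat \<Rightarrow> 'a set) \<Rightarrow> (nat \<Rightarrow> nat) \<Rightarrow> bool" where
  "non_repeating f B h \<longleftrightarrow>
     \<not> (\<exists>p\<ge>1. \<forall>i. infinite_word f B h (i + p) = infinite_word f B h i)"

lemma tower_rep_level:
  assumes t: "tower_rep f B h" and "m \<le> n" "i < h n" "(f ^^ i) ` B n \<inter> tower f B h m \<noteq> {}"
  shows "\<exists>j<h m. (f ^^ i) ` B n \<subseteq> (f ^^ j) ` B m"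
  using assms(2-)
proof (induction n arbitrary: i rule: dec_induct)
  case base
  then show ?case by blast
next
  case (step n)
  have "\<forall>n. tower f B h n \<subseteq> tower f B h (Suc n)"
    using t unfolding tower_rep_def by (elim conjE)
  then have mono: "tower f B h m \<subseteq> tower f B h n"
    using lift_Suc_mono_le[of "tower f B h" m n] step.hyps(1) by simp
  from step.prems(2) obtain x where x: "x \<in> (f ^^ i) ` B (Suc n)" "x \<in> tower f B h m"
    by auto
  then obtain j where j: "j < h n" "x \<in> (f ^^ j) ` B n"
    using mono unfolding tower_def by (meson UN_E lessThan_iff subsetD)
  have "\<forall>n j i. j < h (Suc n) \<longrightarrow> i < h n \<longrightarrow>
        (f ^^ j) ` B (Suc n) \<inter> (f ^^ i) ` B n \<noteq> {} \<longrightarrow>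
        (f ^^ j) ` B (Suc n) \<subseteq> (f ^^ i) ` B n"
    using t unfolding tower_rep_def by (elim conjE)
  then have sub: "(f ^^ i) ` B (Suc n) \<subseteq> (f ^^ j) ` B n"
    using step.prems(1) j x(1) by (meson disjoint_iff)
  have "(f ^^ j) ` B n \<inter> tower f B h m \<noteq> {}"
    using j(2) x(2) by (meson disjoint_iff)
  from step.IH[OF j(1) this] show ?case
    using sub by (meson subset_trans)
qed

lemma tower_word_Suc:
  assumes t: "tower_rep f B h" and i: "i < h n"
  shows "tower_word f B h (Suc n) i = tower_word f B h n i"
proof -
  have dec: "\<forall>m n. m < n \<longrightarrow> B n \<subset> B m"
    using t unfolding tower_rep_def by (elim conjE)
  have sub: "(f ^^ i) ` B (Suc n) \<subseteq> (f ^^ i) ` B n"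
    using dec by (intro image_mono) (meson lessI psubset_imp_subset)
  from dec obtain x where x: "x \<in> B (Suc n)"
    by (meson lessI psubset_imp_ex_mem DiffD1)
  have "\<exists>j<h 0. (f ^^ i) ` B n \<subseteq> (f ^^ j) ` B 0"
    if "j < h 0" "(f ^^ i) ` B (Suc n) \<subseteq> (f ^^ j) ` B 0" for j
  proof (rule tower_rep_level[OF t _ i])
    have "(f ^^ i) x \<in> (f ^^ i) ` B n" "(f ^^ i) x \<in> tower f B h 0"
      using that x sub unfolding tower_def by (meson UN_I imageI lessThan_iff subsetD)+
    then show "(f ^^ i) ` B n \<inter> tower f B h 0 \<noteq> {}" by (meson disjoint_iff)
  qed simp
  moreover have "(f ^^ i) ` B (Suc n) \<subseteq> (f ^^ j) ` B 0"
    if "(f ^^ i) ` B n \<subseteq> (f ^^ j) ` B 0" for j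
    using sub that by (rule subset_trans)
  ultimately have "(\<exists>j<h 0. (f ^^ i) ` B (Suc n) \<subseteq> (f ^^ j) ` B 0) \<longleftrightarrow>
      (\<exists>j<h 0. (f ^^ i) ` B n \<subseteq> (f ^^ j) ` B 0)"
    by meson
  then show ?thesis unfolding tower_word_def by (simp only:)
qed

lemma infinite_word_eq:
  assumes t: "tower_rep f B h" and i: "i < h n"
  shows "infinite_word f B h i = tower_word f B h n i"
proof -
  define m where "m = (LEAST n. i < h n)"
  have m: "i < h m" "m \<le> n"
    unfolding m_def using i by (rule LeastI, rule Least_le)
  have "strict_mono h"
    using t unfolding tower_rep_def by (elim conjE)
  then have "mono h" by (rule strict_mono_mono)
  from m(2) have "tower_word f B h n i = tower_word f B h m i"
  proof (induction n rule: dec_induct)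
    case (step k)
    have "i < h k" using m(1) monoD[OF \<open>mono h\<close> step.hyps(1)] by simp
    then show ?case using tower_word_Suc[OF t] step.IH by simp
  qed simp
  then show ?thesis by (simp add: infinite_word_def m_def)
qed

end

theory Submission
  imports Defs
begin

text \<open>
  Why the theorem holds. Fix a point \<open>x\<close> whose forward orbit visits every \<open>B n\<close> infinitely often
  (Baire) and put \<open>y = g x\<close>. Everything is read off from the two families of visiting times
  \<open>E n = {k. f\<^sup>k x \<in> B n}\<close> and \<open>F n = {k. f\<^sup>k y \<in> B n}\<close>. The aim is a single \<open>\<delta>\<close> such that, for each \<open>n\<close>,
  the sets \<open>F n\<close> and \<open>E n + \<delta>\<close> agree from some time on. Since the \<open>B n\<close> and the leftover sets \<open>L n\<close>
  generate the topology and \<open>x\<close> is recurrent, this forces \<open>f\<^sup>\<delta> (g x) = x\<close>, and the density of the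
  orbit of \<open>x\<close> spreads the equation to the whole space.

  Two features drive the combinatorics. First, the tower conditions make \<open>E n\<close> and \<open>F n\<close> rigid: for
  \<open>n \<le> N\<close> both arise from \<open>E N\<close>, respectively \<open>F N\<close>, by attaching the same finite pattern \<open>D n N\<close> of
  offsets to every element, and distinct elements of \<open>E n\<close> are at least \<open>h n\<close> apart. Second,
  every nonempty open set contains some level \<open>f\<^sup>a (B m)\<close>; for the sets \<open>L n\<close> this is where
  non-periodicity enters (\<open>leftover_contains_level\<close>). Applied to the preimage of \<open>B n\<close>
  under \<open>g\<close>, it gives \<open>m\<close> and \<open>a\<close> with \<open>E m + a \<subseteq> F n\<close>, and symmetrically \<open>F m + b \<subseteq> E n\<close>. As the space
  need not be compact, continuity alone does not make \<open>g\<close> a block code: a priori no bounded window of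
  the orbit of \<open>x\<close> determines whether \<open>g x \<in> B n\<close>. So the argument rests on these inclusions alone.

  From here the argument has three steps. (i) For large \<open>N\<close>, an inclusion \<open>E N + a \<subseteq> F 0\<close> puts the
  shifted start of every \<open>N\<close>-block of \<open>x\<close> inside an \<open>N\<close>-block of \<open>y\<close>, injectively and in order; the
  reverse inclusion bounds the number of blocks of \<open>y\<close> that are skipped. So eventually the \<open>i\<close>-th block
  of \<open>x\<close> starts, after the shift, in the \<open>(i + \<kappa>)\<close>-th block of \<open>y\<close> (\<open>block_index_shift_eventually_const\<close>).
  (ii) Pass to a much higher level \<open>N'\<close>. Both sequences of \<open>N'\<close>-blocks occur with the same period in
  the \<open>N\<close>-block numbering, so by (i) the distance between corresponding \<open>N'\<close>-blocks is known up to an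
  error less than \<open>h N\<close>. On the other hand an inclusion \<open>E M + a' \<subseteq> F N\<close> says that this distance,
  suitably normalised, lies in \<open>D N N'\<close>, whose elements are at least \<open>h N\<close> apart. Hence it is constant
  (\<open>blocks_eventually_translate\<close>). (iii) The constants found at different levels coincide, because two
  different ones would make \<open>E 0\<close> eventually periodic, against non-periodicity of the infinite word.
\<close>

section \<open>Enumerating and matching blocks on the integers\<close>

lemma unbounded_int_set_enumeration:
  fixes S :: "int set"
  assumes unbdd: "\<And>c. \<exists>k\<in>S. c \<le> k"
  obtains L :: "nat \<Rightarrow> int" where "strict_mono L" "range L = {k \<in> S. c \<le> k}"
proof -
  define T where "T = {n. c + int n \<in> S}"
  have "\<exists>n\<ge>m. n \<in> T" for m
  proof -
    obtain k where "k \<in> S" "c + int m \<le> k" using unbdd[of "c + int m"] by blast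
    then have "m \<le> nat (k - c)" "nat (k - c) \<in> T" by (auto simp: T_def)
    then show ?thesis by blast
  qed
  then have inf: "infinite T" by (simp add: infinite_nat_iff_unbounded_le)
  define L where "L = (\<lambda>j. c + int (enumerate T j))"
  have "strict_mono L"
    using enumerate_step[OF inf] by (simp add: strict_mono_Suc_iff L_def)
  moreover have "range L = {k \<in> S. c \<le> k}"
  proof -
    have "range (enumerate T) = T" using bij_enumerate[OF inf] by (simp add: bij_betw_def)
    then have "range L = (\<lambda>n. c + int n) ` T"
      unfolding L_def using image_image[of "\<lambda>n. c + int n" "enumerate T" UNIV] by simp
    also have "\<dots> = {k \<in> S. c \<le> k}"
    proof (intro equalityI subsetI)
      fix k assume "k \<in> {k \<in> S. c \<le> k}"
      then have "k = c + int (nat (k - c))" "nat (k - c) \<in> T" by (auto simp: T_def)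
      then show "k \<in> (\<lambda>n. c + int n) ` T" by blast
    qed (auto simp: T_def)
    finally show ?thesis .
  qed
  ultimately show ?thesis using that by blast
qed

lemma nat_mono_bounded_eventually_const:
  fixes u :: "nat \<Rightarrow> nat"
  assumes "mono u" and bdd: "\<And>i. u i \<le> C"
  shows "\<exists>i\<^sub>0. \<forall>i\<ge>i\<^sub>0. u i = u i\<^sub>0"
proof -
  have fin: "finite (range u)" using bdd by (auto intro: finite_subset[of _ "{..C}"])
  then have "Max (range u) \<in> range u" by (intro Max_in) auto
  then obtain i0 where i0: "u i0 = Max (range u)" by auto
  have "u i = u i0" if "i0 \<le> i" for i
    using monoD[OF \<open>mono u\<close> that] i0 Max_ge[OF fin, of "u i"] by auto
  then show ?thesis by blast
qed

text \<open>Sending \<open>i\<close> to the index \<open>\<phi> i\<close> of the block of \<open>r\<close> that contains \<open>l i + a\<close> is strictly increasing,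
  so \<open>\<phi> i - i\<close> is nondecreasing. The symmetric map, composed with \<open>\<phi>\<close>, moves positions forward
  by at most \<open>a + b\<close>, hence indices by a bounded amount; so \<open>\<phi> i - i\<close> is bounded and eventually constant.\<close>

lemma block_index_shift_eventually_const:
  fixes l r :: "nat \<Rightarrow> int"
  assumes w: "0 < w"
    and lgap: "\<And>i. l i + w \<le> l (Suc i)" and rgap: "\<And>i. r i + w \<le> r (Suc i)"
    and lr: "\<And>i. \<exists>j. r j \<le> l i + a \<and> l i + a < r j + w"
    and rl: "\<And>i. i\<^sub>1 \<le> i \<Longrightarrow> \<exists>j. l j \<le> r i + b \<and> r i + b < l j + w"
  obtains \<kappa> i\<^sub>2 where "\<And>i. i\<^sub>2 \<le> i \<Longrightarrow> r (i + \<kappa>) \<le> l i + a \<and> l i + a < r (i + \<kappa>) + w"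
proof -
  have "l i < l (Suc i)" "r i < r (Suc i)" for i
    using lgap[of i] rgap[of i] w by linarith+
  then have lm: "strict_mono l" and rm: "strict_mono r"
    by (simp_all add: strict_mono_Suc_iff)
  obtain \<phi> where \<phi>: "\<And>i. r (\<phi> i) \<le> l i + a \<and> l i + a < r (\<phi> i) + w"
    using lr by metis
  obtain \<psi> where \<psi>: "\<And>i. i\<^sub>1 \<le> i \<Longrightarrow> l (\<psi> i) \<le> r i + b \<and> r i + b < l (\<psi> i) + w"
    using rl by metis
  have \<phi>_mono: "strict_mono \<phi>" unfolding strict_mono_Suc_iff
  proof (intro allI)
    fix i
    have "r (\<phi> i) < r (\<phi> (Suc i))" using \<phi>[of i] \<phi>[of "Suc i"] lgap[of i] by linarith
    then show "\<phi> i < \<phi> (Suc i)" by (simp only: strict_mono_less[OF rm])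
  qed
  have \<psi>_mono: "strict_mono (\<lambda>i. \<psi> (i + i\<^sub>1))" unfolding strict_mono_Suc_iff
  proof (intro allI)
    fix i
    have "l (\<psi> (i + i\<^sub>1)) < l (\<psi> (Suc i + i\<^sub>1))"
      using \<psi>[of "i + i\<^sub>1"] \<psi>[of "Suc i + i\<^sub>1"] rgap[of "i + i\<^sub>1"] by simp
    then show "\<psi> (i + i\<^sub>1) < \<psi> (Suc i + i\<^sub>1)" by (simp only: strict_mono_less[OF lm])
  qed
  have \<psi>_ge: "j \<le> \<psi> j + i\<^sub>1" if "i\<^sub>1 \<le> j" for j
    using strict_mono_imp_increasing[OF \<psi>_mono, of "j - i\<^sub>1"] that by simp
  define C where "C = nat \<bar>a + b\<bar> + 1"
  have l_far: "l i + int n \<le> l (i + n)" for i n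
  proof (induction n)
    case (Suc n)
    then show ?case using lgap[of "i + n"] w by simp
  qed simp
  have \<phi>_le: "\<phi> i \<le> i + (C + i\<^sub>1)" for i
  proof (cases "i\<^sub>1 \<le> \<phi> i")
    case True
    have "l (\<psi> (\<phi> i)) \<le> r (\<phi> i) + b" using \<psi>[OF True] by simp
    also have "\<dots> \<le> l i + a + b" using \<phi>[of i] by simp
    also have "\<dots> < l i + int C" unfolding C_def by linarith
    also have "\<dots> \<le> l (i + C)" by (rule l_far)
    finally have "\<psi> (\<phi> i) < i + C" by (simp only: strict_mono_less[OF lm])
    then show ?thesis using \<psi>_ge[OF True] by simp
  qed simp
  have ge: "i \<le> \<phi> i" for i using \<phi>_mono by (rule strict_mono_imp_increasing)
  have "mono (\<lambda>i. \<phi> i - i)" unfolding mono_iff_le_Suc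
  proof (intro allI)
    fix i
    have "\<phi> i < \<phi> (Suc i)" using \<phi>_mono by (simp add: strict_mono_Suc_iff)
    then show "\<phi> i - i \<le> \<phi> (Suc i) - Suc i" by simp
  qed
  moreover have "\<phi> i - i \<le> C + i\<^sub>1" for i using \<phi>_le[of i] by simp
  ultimately have "\<exists>i\<^sub>0. \<forall>i\<ge>i\<^sub>0. \<phi> i - i = \<phi> i\<^sub>0 - i\<^sub>0"
    by (rule nat_mono_bounded_eventually_const)
  then obtain i2 where i2: "\<phi> i - i = \<phi> i2 - i2" if "i2 \<le> i" for i
    by auto
  show ?thesis
  proof (rule that[of i2 "\<phi> i2 - i2"])
    fix i assume "i2 \<le> i"
    then have "i + (\<phi> i2 - i2) = \<phi> i" using i2[of i] ge[of i] by simp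
    then show "r (i + (\<phi> i2 - i2)) \<le> l i + a \<and> l i + a < r (i + (\<phi> i2 - i2)) + w"
      using \<phi>[of i] by simp
  qed
qed

text \<open>The times at which one orbit visits the bases of a nested family of towers: \<open>E n\<close> is the set of
  starting times of the blocks of level \<open>n\<close>, and \<open>D n N\<close> lists the positions of the blocks of level \<open>n\<close>
  inside a block of level \<open>N\<close>, which are the same in every such block.\<close>

locale block_sequence =
  fixes h :: "nat \<Rightarrow> nat" and D :: "nat \<Rightarrow> nat \<Rightarrow> nat set" and E :: "nat \<Rightarrow> int set"
  assumes decompose: "n \<le> N \<Longrightarrow> E n = {e + int d |e d. e \<in> E N \<and> d \<in> D n N}"
    and separated: "k \<in> E n \<Longrightarrow> k' \<in> E n \<Longrightarrow> k < k' \<Longrightarrow> k + int (h n) \<le> k'"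
    and unbounded: "\<exists>k\<in>E n. c \<le> k"
    and offset_less: "n \<le> N \<Longrightarrow> d \<in> D n N \<Longrightarrow> d < h N"
    and offsets_mono: "n \<le> m \<Longrightarrow> m \<le> N \<Longrightarrow> D m N \<subseteq> D n N"
    and zero_offset: "n \<le> N \<Longrightarrow> 0 \<in> D n N"
    and height_pos: "0 < h n"
begin

lemma finite_offsets:
  assumes "n \<le> N"
  shows "finite (D n N)"
proof (rule finite_subset)
  show "D n N \<subseteq> {..<h N}" using offset_less[OF assms] by blast
qed simp


lemma E_antimono:
  assumes "n \<le> N"
  shows "E N \<subseteq> E n"
proof
  fix k assume "k \<in> E N"
  then have "k = k + int 0 \<and> k \<in> E N \<and> 0 \<in> D n N" using zero_offset[OF assms] by simp
  then show "k \<in> E n" unfolding decompose[OF assms] by blast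
qed

lemma block_unique:
  assumes "e \<in> E N" "e' \<in> E N" "e \<le> k" "k < e + int (h N)" "e' \<le> k" "k < e' + int (h N)"
  shows "e = e'"
  using separated[OF assms(1,2)] separated[OF assms(2,1)] assms(3-) by linarith

lemma in_block_offset:
  assumes "n \<le> N" "e \<in> E N" "k \<in> E n" "e \<le> k" "k < e + int (h N)"
  shows "nat (k - e) \<in> D n N"
proof -
  obtain e' d where k: "k = e' + int d" "e' \<in> E N" "d \<in> D n N"
    using decompose[OF assms(1)] assms(3) by auto
  have "e = e'"
    using block_unique[of e N e' k] k offset_less[OF assms(1) k(3)] assms by auto
  then show ?thesis using k by simp
qed

lemma offsets_separated:
  assumes "n \<le> N" "d \<in> D n N" "d' \<in> D n N" "d < d'"
  shows "d + h n \<le> d'"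
proof -
  obtain e where "e \<in> E N" using unbounded by blast
  then have "e + int d \<in> E n" "e + int d' \<in> E n" using decompose[OF assms(1)] assms by auto
  from separated[OF this] show ?thesis using assms(4) by simp
qed

text \<open>If \<open>L\<close> numbers the blocks of level \<open>N\<close> and each of them holds \<open>q\<close> blocks of level \<open>n\<close>, then the
  \<open>i\<close>-th block of level \<open>n\<close> is number \<open>i mod q\<close> inside the large block number \<open>i div q\<close>. Thus the large
  blocks form an arithmetic progression in the numbering of the small ones.\<close>

lemma enumerate_blocks:
  assumes nN: "n \<le> N" and L: "strict_mono L" "range L = {k \<in> E N. c \<le> k}"
    and d: "bij_betw d {..<q} (D n N)" "strict_mono_on {..<q} d"
  defines "l \<equiv> \<lambda>i. L (i div q) + int (d (i mod q))"
  shows "l i + int (h n) \<le> l (Suc i)" and "range l = {k \<in> E n. L 0 \<le> k}"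
proof -
  have "D n N \<noteq> {}" using zero_offset[OF nN] by blast
  then have q: "0 < q" using d(1) by (cases q) (auto simp: bij_betw_def)
  have dD: "d x \<in> D n N" if "x < q" for x using d(1) that by (auto simp: bij_betw_def)
  have LE: "L j \<in> E N" "c \<le> L j" for j using L(2) by auto
  have lE: "l i \<in> E n" for i
  proof -
    have "d (i mod q) \<in> D n N" using dD q by simp
    then show ?thesis using LE(1) unfolding l_def decompose[OF nN] by blast
  qed
  have "l i < l (Suc i)"
  proof (cases "Suc (i mod q) = q")
    case True
    then have "Suc i mod q = 0" "Suc i div q = Suc (i div q)"
      using q by (auto simp: mod_Suc div_Suc)
    moreover have "L (i div q) + int (h N) \<le> L (Suc (i div q))"
      using LE L(1) by (intro separated[of _ N]) (auto simp: strict_mono_Suc_iff)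
    moreover have "d (i mod q) < h N" using offset_less[OF nN] dD q by simp
    ultimately show ?thesis by (simp add: l_def)
  next
    case False
    then have "Suc i mod q = Suc (i mod q)" "Suc i div q = i div q" "Suc (i mod q) < q"
      using q mod_less_divisor[OF q, of i] by (auto simp: mod_Suc div_Suc)
    moreover have "d (i mod q) < d (Suc (i mod q))"
      using \<open>Suc (i mod q) < q\<close> by (intro strict_mono_onD[OF d(2)]) auto
    ultimately show ?thesis by (simp add: l_def)
  qed
  then show "l i + int (h n) \<le> l (Suc i)" by (intro separated lE)
  show "range l = {k \<in> E n. L 0 \<le> k}"
  proof (intro equalityI subsetI)
    fix k assume "k \<in> range l"
    then obtain i where "k = l i" by auto
    moreover have "L 0 \<le> L (i div q)" by (simp add: strict_mono_less_eq[OF L(1)])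
    ultimately show "k \<in> {k \<in> E n. L 0 \<le> k}" using lE by (simp add: l_def)
  next
    fix k assume k: "k \<in> {k \<in> E n. L 0 \<le> k}"
    then obtain e x where e: "k = e + int x" "e \<in> E N" "x \<in> D n N"
      using decompose[OF nN] by auto
    have x: "x < h N" using offset_less[OF nN e(3)] .
    have "L 0 \<le> e"
    proof (rule ccontr)
      assume "\<not> L 0 \<le> e"
      then have "e + int (h N) \<le> L 0" using e LE by (intro separated[of _ N]) auto
      then show False using x e k by simp
    qed
    then have "e \<in> range L" using L(2) LE(2)[of 0] e(2) by auto
    then obtain j where j: "e = L j" by auto
    from e(3) obtain y where y: "y < q" "x = d y" using d(1) by (auto simp: bij_betw_def)
    then have "k = l (q * j + y)" using e j q by (simp add: l_def)
    then show "k \<in> range l" by blast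
  qed
qed

end

text \<open>Two orbits of the same map: later those of \<open>x\<close> and of \<open>g x\<close>.\<close>

locale block_sequence_pair =
  E: block_sequence h D E + F: block_sequence h D F
  for h D E F
begin

text \<open>Two levels play against each other. At level \<open>N\<close> the blocks of \<open>E\<close> and \<open>F\<close> are matched with a
  constant shift of index, which determines the distance between corresponding blocks of level \<open>N'\<close> up
  to an error below \<open>h N\<close>. The inclusion \<open>E M + a' \<subseteq> F N\<close> makes this distance take values in a
  translate of \<open>D N N'\<close>, whose gaps are at least \<open>h N\<close>; so it can take only one value. The
  cardinality assumption ensures that some sub-block of level \<open>M\<close> is matched so far from the ends of
  a block of level \<open>N'\<close> that the passage from \<open>a\<close> to \<open>a'\<close> does not leave that block.\<close>

lemma blocks_eventually_translate:
  assumes a: "\<And>k. k \<in> E N \<Longrightarrow> k + a \<in> F 0" and b: "\<And>k. k \<in> F N \<Longrightarrow> k + b \<in> E 0"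
    and a': "\<And>k. k \<in> E M \<Longrightarrow> k + a' \<in> F N"
    and NM: "N \<le> M" and MN': "M \<le> N'"
    and card: "2 * nat \<bar>a' - a\<bar> + h N < card (D M N')"
  obtains \<delta> c where "\<And>k. c \<le> k \<Longrightarrow> k \<in> E N' \<longleftrightarrow> k + \<delta> \<in> F N'"
proof -
  have NN': "N \<le> N'" using NM MN' by simp
  define q where "q = card (D N N')"
  obtain d where d: "bij_betw d {..<q} (D N N')" "strict_mono_on {..<q} d"
    using ex_bij_betw_strict_mono_card[OF E.finite_offsets[OF NN']] unfolding q_def by metis
  have q: "0 < q"
    unfolding q_def using E.zero_offset[OF NN'] E.finite_offsets[OF NN'] by (auto simp: card_gt_0_iff)
  have dD: "d x \<in> D N N'" if "x < q" for x using d(1) that by (auto simp: bij_betw_def)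
  obtain R :: "nat \<Rightarrow> int" where R: "strict_mono R" "range R = {k \<in> F N'. 0 \<le> k}"
    using unbounded_int_set_enumeration[OF F.unbounded] by metis
  \<comment> \<open>The enumeration of \<open>E\<close> starts so late that the blocks of \<open>F\<close> into which its elements are
    shifted by \<open>a\<close> start at \<open>R 0\<close> or later.\<close>
  obtain L :: "nat \<Rightarrow> int" where L: "strict_mono L" "range L = {k \<in> E N'. R 0 - a + int (h N) \<le> k}"
    using unbounded_int_set_enumeration[OF E.unbounded] by metis
  define l where "l i = L (i div q) + int (d (i mod q))" for i
  define r where "r i = R (i div q) + int (d (i mod q))" for i
  note l = E.enumerate_blocks[OF NN' L d, folded l_def]
  note r = F.enumerate_blocks[OF NN' R d, folded r_def]
  have lE: "l i \<in> E N" "L 0 \<le> l i" and rF: "r i \<in> F N" for i using l(2) r(2) by auto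
  have "\<exists>j. r j \<le> l i + a \<and> l i + a < r j + int (h N)" for i
  proof -
    have "l i + a \<in> F 0" using a lE by simp
    then obtain e x where e: "l i + a = e + int x" "e \<in> F N" "x \<in> D 0 N"
      using F.decompose[of 0 N] by auto
    have x: "x < h N" using F.offset_less[OF _ e(3)] by simp
    have "R 0 - a + int (h N) \<le> L 0" using L(2) by auto
    then have "R 0 \<le> e" using e(1) x lE(2)[of i] by simp
    then obtain j where "e = r j" using r(2) e(2) by blast
    then have "r j \<le> l i + a \<and> l i + a < r j + int (h N)" using e(1) x by simp
    then show ?thesis ..
  qed
  moreover have "\<exists>j. l j \<le> r i + b \<and> r i + b < l j + int (h N)"
    if i: "nat (L 0 + int (h N) - b - R 0) \<le> i" for i
  proof -
    have "r 0 + int i \<le> r i"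
    proof (induction i)
      case (Suc i)
      then show ?case using r(1)[of i] F.height_pos[of N] by simp
    qed simp
    moreover have "R 0 \<le> r 0" by (simp add: r_def)
    ultimately have far: "L 0 + int (h N) \<le> r i + b" using i by linarith
    have "r i + b \<in> E 0" using b rF by simp
    then obtain e x where e: "r i + b = e + int x" "e \<in> E N" "x \<in> D 0 N"
      using E.decompose[of 0 N] by auto
    have x: "x < h N" using E.offset_less[OF _ e(3)] by simp
    have "L 0 \<le> e" using e(1) x far by simp
    then obtain j where "e = l j" using l(2) e(2) by blast
    then have "l j \<le> r i + b \<and> r i + b < l j + int (h N)" using e(1) x by simp
    then show ?thesis ..
  qed
  moreover have "0 < int (h N)" using E.height_pos by simp
  ultimately obtain \<kappa> i2
    where \<kappa>: "\<And>i. i2 \<le> i \<Longrightarrow> r (i + \<kappa>) \<le> l i + a \<and> l i + a < r (i + \<kappa>) + int (h N)"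
    using block_index_shift_eventually_const[of "int (h N)" l r a] l(1) r(1) by metis
  \<comment> \<open>The offsets too close to an end of a block of level \<open>N'\<close>, where moving the reference point by
    \<open>a' - a\<close> might leave the block. Their number is bounded independently of \<open>N'\<close>, and \<open>x \<mapsto> (x + \<kappa>) mod q\<close>
    is injective, so some sub-block avoids them.\<close>
  define bad where "bad = {x \<in> D N N'. int x + a' - a < 0 \<or> int (h N') < int x + a' - a + int (h N)}"
  obtain x where x: "x < q" "d x \<in> D M N'" "d ((x + \<kappa>) mod q) \<notin> bad"
  proof -
    define X where "X = {x. x < q \<and> d x \<in> D M N'}"
    have "D M N' \<subseteq> D N N'" using E.offsets_mono[OF NM MN'] .
    then have "d ` X = D M N'" using d(1) unfolding X_def bij_betw_def by auto
    moreover have "inj_on d X" 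
      using d(1) unfolding X_def bij_betw_def by (auto intro: inj_on_subset)
    ultimately have cardX: "card X = card (D M N')" by (metis card_image)
    have "inj_on (\<lambda>x. d ((x + \<kappa>) mod q)) X"
    proof (rule inj_onI)
      fix x y assume xy: "x \<in> X" "y \<in> X" "d ((x + \<kappa>) mod q) = d ((y + \<kappa>) mod q)"
      then have "(x + \<kappa>) mod q = (y + \<kappa>) mod q"
        using d(1) q by (auto simp: bij_betw_def inj_on_def)
      then have "x mod q = y mod q" by (simp add: nat_mod_eq_iff)
      then show "x = y" using xy by (simp add: X_def)
    qed
    then have cardI: "card ((\<lambda>x. d ((x + \<kappa>) mod q)) ` X) = card X" by (rule card_image)
    have finbad: "finite bad" unfolding bad_def using E.finite_offsets[OF NN'] by simp
    have "bad \<subseteq> {..<nat \<bar>a' - a\<bar>} \<union> {h N' - (h N + nat \<bar>a' - a\<bar>)..<h N'}"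
      using E.offset_less[OF NN'] unfolding bad_def by auto
    then have "card bad \<le> card ({..<nat \<bar>a' - a\<bar>} \<union> {h N' - (h N + nat \<bar>a' - a\<bar>)..<h N'})"
      by (intro card_mono) auto
    also have "\<dots> \<le> nat \<bar>a' - a\<bar> + (h N + nat \<bar>a' - a\<bar>)"
      by (rule order_trans[OF card_Un_le]) (simp only: card_lessThan card_atLeastLessThan, arith)
    finally have "card bad \<le> 2 * nat \<bar>a' - a\<bar> + h N" by simp
    then have "\<not> (\<lambda>x. d ((x + \<kappa>) mod q)) ` X \<subseteq> bad"
      using card_mono[OF finbad] cardI cardX card by (metis leD le_trans)
    then show ?thesis using that unfolding X_def by blast
  qed
  \<comment> \<open>Block \<open>x\<close> inside the \<open>j\<close>-th large block of \<open>E\<close> is matched with block \<open>y\<close> inside the \<open>(j + s)\<close>-th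
    large block of \<open>F\<close>, with the same \<open>s\<close> and \<open>y\<close> for all \<open>j\<close>.\<close>
  define s where "s = (x + \<kappa>) div q"
  define y where "y = (x + \<kappa>) mod q"
  define p where "p j = L j + int (d x) + a' - R (j + s)" for j
  have y: "y < q" unfolding y_def using q by simp
  have p_range: "int (d y) + a' - a \<le> p j \<and> p j < int (d y) + a' - a + int (h N)" if "i2 \<le> j" for j
  proof -
    have "j \<le> q * j + x" using q by (cases q) auto
    then have "i2 \<le> q * j + x" using that by simp
    moreover have "l (q * j + x) = L j + int (d x)" using x(1) q by (simp add: l_def)
    moreover have "r (q * j + x + \<kappa>) = R (j + s) + int (d y)"
      using q by (simp add: r_def s_def y_def add.assoc)
    ultimately show ?thesis using \<kappa>[of "q * j + x"] by (simp add: p_def)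
  qed
  have y_good: "0 \<le> int (d y) + a' - a" "int (d y) + a' - a + int (h N) \<le> int (h N')"
    using x(3) dD[OF y] unfolding bad_def y_def by auto
  have RF: "R j \<in> F N'" for j using R(2) by auto
  have LE: "L j \<in> E N'" for j using L(2) by auto
  have p_offset: "nat (p j) \<in> D N N'" if "i2 \<le> j" for j
  proof -
    have "L j + int (d x) \<in> E M" using LE x(2) unfolding E.decompose[OF MN'] by blast
    then have "L j + int (d x) + a' \<in> F N" by (rule a')
    from F.in_block_offset[OF NN' RF this, of "j + s"] show ?thesis
      using p_range[OF that] y_good by (simp add: p_def)
  qed
  have p_const: "p j = p i2" if "i2 \<le> j" for j
    using E.offsets_separated[OF NN' p_offset p_offset, of j i2]
      E.offsets_separated[OF NN' p_offset p_offset, of i2 j]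
      p_range[OF that] p_range[of i2] y_good that
    by (cases "p j" "p i2" rule: linorder_cases) (auto simp: nat_less_iff)
  define \<delta> where "\<delta> = int (d x) + a' - p i2"
  have LR: "L j + \<delta> = R (j + s)" if "i2 \<le> j" for j
    using p_const[OF that] by (simp add: \<delta>_def p_def)
  have "k \<in> E N' \<longleftrightarrow> k + \<delta> \<in> F N'" if k: "L i2 \<le> k" for k
  proof
    assume "k \<in> E N'"
    moreover have "R 0 - a + int (h N) \<le> L i2" using L(2) by auto
    ultimately have "k \<in> range L" using L(2) k by simp
    then obtain j where j: "k = L j" by auto
    then have "i2 \<le> j" using k by (simp add: strict_mono_less_eq[OF L(1)])
    then show "k + \<delta> \<in> F N'" using LR j RF by simp
  next
    assume kF: "k + \<delta> \<in> F N'"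
    have ge: "R (i2 + s) \<le> k + \<delta>" using LR[of i2] k by simp
    moreover have "0 \<le> R (i2 + s)" using R(2) by auto
    ultimately have "k + \<delta> \<in> range R" using R(2) kF by simp
    then obtain j where j: "k + \<delta> = R j" by auto
    then have "i2 + s \<le> j" using ge by (simp add: strict_mono_less_eq[OF R(1)])
    then have "L (j - s) + \<delta> = R j" using LR[of "j - s"] by simp
    then have "k = L (j - s)" using j by simp
    then show "k \<in> E N'" using LE by simp
  qed
  then show ?thesis using that by blast
qed

lemma eventually_translate_antimono:
  assumes "n \<le> N" and tr: "\<And>k. c \<le> k \<Longrightarrow> k \<in> E N \<longleftrightarrow> k + \<delta> \<in> F N"
    and k: "c + int (h N) \<le> k"
  shows "k \<in> E n \<longleftrightarrow> k + \<delta> \<in> F n"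
proof -
  have mem_E: "k \<in> E n \<longleftrightarrow> (\<exists>d\<in>D n N. k - int d \<in> E N)"
    unfolding E.decompose[OF assms(1)] by force
  have mem_F: "k + \<delta> \<in> F n \<longleftrightarrow> (\<exists>d\<in>D n N. k - int d + \<delta> \<in> F N)"
    unfolding F.decompose[OF assms(1)] by (force simp: algebra_simps)
  have "k - int d \<in> E N \<longleftrightarrow> k - int d + \<delta> \<in> F N" if "d \<in> D n N" for d
    using E.offset_less[OF assms(1) that] k by (intro tr) simp
  then show ?thesis unfolding mem_E mem_F by blast
qed

text \<open>The level-wise translations of \<open>blocks_eventually_translate\<close> restrict to translations at level \<open>0\<close>,
  and two different translations there would give \<open>E 0\<close> a period.\<close>

lemma uniform_translation:
  assumes EF: "\<And>n. \<exists>m a. \<forall>k\<in>E m. k + a \<in> F n" and FE: "\<And>n. \<exists>m b. \<forall>k\<in>F m. k + b \<in> E n"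
    and many: "\<And>n C K. \<exists>N\<ge>K. n \<le> N \<and> C < card (D n N)"
    and aperiodic: "\<And>p c. 0 < p \<Longrightarrow> \<exists>k\<ge>c. \<not> (k \<in> E 0 \<longleftrightarrow> k + p \<in> E 0)"
  shows "\<exists>\<delta>. \<forall>n. \<exists>c. \<forall>k\<ge>c. k \<in> E n \<longleftrightarrow> k + \<delta> \<in> F n"
proof -
  obtain m0 a where a: "\<forall>k\<in>E m0. k + a \<in> F 0" using EF by blast
  obtain n0 b where b: "\<forall>k\<in>F n0. k + b \<in> E 0" using FE by blast
  define N where "N = max m0 n0"
  obtain M0 a' where a': "\<forall>k\<in>E M0. k + a' \<in> F N" using EF by blast
  define M where "M = max M0 N"
  have anti: "E N \<subseteq> E m0" "F N \<subseteq> F n0" "E M \<subseteq> E M0"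
    unfolding N_def M_def by (auto intro!: E.E_antimono F.E_antimono)
  have trans: "\<exists>\<delta>. \<forall>n\<le>K. \<exists>c. \<forall>k\<ge>c. k \<in> E n \<longleftrightarrow> k + \<delta> \<in> F n" for K
  proof -
    obtain N' where N': "K \<le> N'" "M \<le> N'" "2 * nat \<bar>a' - a\<bar> + h N < card (D M N')"
      using many by blast
    have "\<exists>\<delta> c. \<forall>k\<ge>c. k \<in> E N' \<longleftrightarrow> k + \<delta> \<in> F N'"
    proof (rule blocks_eventually_translate[of N a b M a' N'])
      show "k + a \<in> F 0" if "k \<in> E N" for k using a anti(1) that by blast
      show "k + b \<in> E 0" if "k \<in> F N" for k using b anti(2) that by blast
      show "k + a' \<in> F N" if "k \<in> E M" for k using a' anti(3) that by blast
      show "N \<le> M" by (simp add: M_def)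
    qed (use N' in blast)+
    then obtain \<delta> c where tr: "\<And>k. c \<le> k \<Longrightarrow> k \<in> E N' \<longleftrightarrow> k + \<delta> \<in> F N'" by blast
    have "\<forall>k\<ge>c + int (h N'). k \<in> E n \<longleftrightarrow> k + \<delta> \<in> F n" if "n \<le> K" for n
      using eventually_translate_antimono[OF _ tr, of n] that N'(1) by simp
    then show ?thesis by blast
  qed
  have unique: "\<delta> \<le> \<delta>'"
    if c: "\<forall>k\<ge>c. k \<in> E 0 \<longleftrightarrow> k + \<delta> \<in> F 0" and c': "\<forall>k\<ge>c'. k \<in> E 0 \<longleftrightarrow> k + \<delta>' \<in> F 0"
    for \<delta> \<delta>' c c'
  proof (rule ccontr)
    assume "\<not> \<delta> \<le> \<delta>'"
    then obtain k where k: "max c c' \<le> k" "\<not> (k \<in> E 0 \<longleftrightarrow> k + (\<delta> - \<delta>') \<in> E 0)"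
      using aperiodic[of "\<delta> - \<delta>'" "max c c'"] by auto
    have "k \<in> E 0 \<longleftrightarrow> k + \<delta> \<in> F 0" using c k(1) by simp
    also have "\<dots> \<longleftrightarrow> k + (\<delta> - \<delta>') \<in> E 0"
      using c'[rule_format, of "k + (\<delta> - \<delta>')"] k(1) \<open>\<not> \<delta> \<le> \<delta>'\<close> by simp
    finally show False using k(2) by blast
  qed
  obtain \<delta> where \<delta>: "\<exists>c. \<forall>k\<ge>c. k \<in> E 0 \<longleftrightarrow> k + \<delta> \<in> F 0" using trans[of 0] by blast
  have "\<exists>c. \<forall>k\<ge>c. k \<in> E n \<longleftrightarrow> k + \<delta> \<in> F n" for n
  proof -
    obtain \<delta>' where \<delta>': "\<forall>m\<le>n. \<exists>c. \<forall>k\<ge>c. k \<in> E m \<longleftrightarrow> k + \<delta>' \<in> F m" using trans[of n] by blast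
    then have "\<exists>c. \<forall>k\<ge>c. k \<in> E 0 \<longleftrightarrow> k + \<delta>' \<in> F 0" by blast
    then have "\<delta>' = \<delta>" using unique \<delta> by (meson order_antisym)
    then show ?thesis using \<delta>' by blast
  qed
  then show ?thesis by blast
qed

end

section \<open>Integer iterates of a homeomorphism\<close>

lemma zpow_0 [simp]: "zpow f 0 x = x" by (simp add: zpow_def)

lemma zpow_of_nat: "zpow f (int n) = f ^^ n" by (simp add: zpow_def)

lemma zpow_plus1:
  assumes "bij f"
  shows "zpow f (k + 1) x = f (zpow f k x)"
proof (cases "0 \<le> k")
  case True
  then have "nat (k + 1) = Suc (nat k)" by simp
  then show ?thesis using True by (simp add: zpow_def)
next
  case False
  then have "nat (- k) = Suc (nat (- (k + 1)))" by simp
  then have "zpow f k x = inv f ((inv f ^^ nat (- (k + 1))) x)" using False by (simp add: zpow_def)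
  then have "f (zpow f k x) = (inv f ^^ nat (- (k + 1))) x"
    using assms by (simp add: bij_is_surj surj_f_inv_f)
  also have "\<dots> = zpow f (k + 1) x" using False by (cases "k = -1") (auto simp: zpow_def)
  finally show ?thesis by simp
qed

lemma zpow_add:
  assumes "bij f"
  shows "zpow f (i + j) x = zpow f i (zpow f j x)"
proof (induction i rule: int_induct[where k = 0])
  case (step1 i)
  have "zpow f (i + 1 + j) x = f (zpow f (i + j) x)"
    using zpow_plus1[OF assms, of "i + j" x] by (simp add: algebra_simps)
  then show ?case using step1 by (simp add: zpow_plus1[OF assms])
next
  case (step2 i)
  have "f (zpow f (i - 1 + j) x) = zpow f (i + j) x"
    using zpow_plus1[OF assms, of "i - 1 + j" x] by (simp add: algebra_simps)
  also have "\<dots> = zpow f (i - 1 + 1) (zpow f j x)" using step2 by simp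
  also have "\<dots> = f (zpow f (i - 1) (zpow f j x))" by (rule zpow_plus1[OF assms])
  finally show ?case using bij_is_inj[OF assms] by (simp add: inj_eq)
qed simp

lemma mem_zpow_image:
  assumes "bij f"
  shows "x \<in> zpow f k ` A \<longleftrightarrow> zpow f (- k) x \<in> A"
proof
  assume "zpow f (- k) x \<in> A"
  moreover have "x = zpow f k (zpow f (- k) x)" using zpow_add[OF assms, of k "- k" x] by simp
  ultimately show "x \<in> zpow f k ` A" by blast
next
  assume "x \<in> zpow f k ` A"
  then obtain z where "x = zpow f k z" "z \<in> A" by blast
  then show "zpow f (- k) x \<in> A" using zpow_add[OF assms, of "- k" k z] by simp
qed

lemma zpow_commute:
  assumes "bij f" and "g \<circ> f = f \<circ> g"
  shows "g (zpow f k x) = zpow f k (g x)"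
proof (induction k rule: int_induct[where k = 0])
  case (step1 i)
  then show ?case using fun_cong[OF assms(2)] by (simp add: zpow_plus1[OF assms(1)])
next
  case (step2 i)
  have "f (g (zpow f (i - 1) x)) = g (zpow f i x)"
    using zpow_plus1[OF assms(1), of "i - 1" x] fun_cong[OF assms(2), of "zpow f (i - 1) x"] by simp
  also have "\<dots> = f (zpow f (i - 1) (g x))"
    using zpow_plus1[OF assms(1), of "i - 1" "g x"] step2 by simp
  finally show ?case using bij_is_inj[OF assms(1)] by (simp add: inj_eq)
qed simp

lemma homeo_bij: "homeo f \<Longrightarrow> bij f"
  by (rule o_bij[of "inv f"]) (auto simp: homeo_def homeomorphism_def)

lemma homeo_continuous:
  assumes "homeo f"
  shows "continuous_on UNIV f" "continuous_on UNIV (inv f)"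
  using assms by (auto simp: homeo_def homeomorphism_def)

lemma continuous_on_zpow:
  assumes "homeo f"
  shows "continuous_on A (zpow f k)"
proof -
  have "continuous_on UNIV (u ^^ n)" if "continuous_on UNIV u" for u :: "'a \<Rightarrow> 'a" and n
    using that
  proof (induction n)
    case (Suc n)
    have "continuous_on (range (u ^^ n)) u" using Suc.prems by (rule continuous_on_subset) simp
    with Suc.IH[OF Suc.prems] have "continuous_on UNIV (u \<circ> (u ^^ n))"
      by (rule continuous_on_compose)
    then show ?case by simp
  qed (simp add: id_def)
  then have "continuous_on UNIV (f ^^ nat k)" "continuous_on UNIV (inv f ^^ nat (- k))"
    using homeo_continuous[OF assms] by blast+
  then have "continuous_on UNIV (zpow f k)" by (simp only: zpow_def split: if_split) blast
  then show ?thesis by (rule continuous_on_subset) simp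
qed

section \<open>Visiting times and levels of a tower representation\<close>

definition visits :: "('a \<Rightarrow> 'a) \<Rightarrow> 'a set \<Rightarrow> 'a \<Rightarrow> int set" where
  "visits f A x = {k. zpow f k x \<in> A}"

text \<open>The levels of the \<open>N\<close>-th tower that lie in the base of the \<open>n\<close>-th; for \<open>n \<le> N\<close>
  every other level of the \<open>N\<close>-th tower misses \<open>B n\<close> (\<open>level_base_cases\<close>).\<close>

definition offsets :: "('a \<Rightarrow> 'a) \<Rightarrow> (nat \<Rightarrow> 'a set) \<Rightarrow> (nat \<Rightarrow> nat) \<Rightarrow> nat \<Rightarrow> nat \<Rightarrow> nat set" where
  "offsets f B h n N = {d. d < h N \<and> (f ^^ d) ` B N \<subseteq> B n}"

lemma mem_visits: "k \<in> visits f A x \<longleftrightarrow> zpow f k x \<in> A"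
  by (simp add: visits_def)

locale rank_one_tower =
  fixes f :: "'a::polish_space \<Rightarrow> 'a" and B :: "nat \<Rightarrow> 'a set" and h :: "nat \<Rightarrow> nat"
  assumes homeo: "homeo f" and rep: "tower_rep f B h"
begin

lemma bij: "bij f" using homeo by (rule homeo_bij)

lemmas mem_image = mem_zpow_image[OF bij]

lemma B_strict: "m < n \<Longrightarrow> B n \<subset> B m"
proof -
  have "\<forall>m n. m < n \<longrightarrow> B n \<subset> B m"
    using rep unfolding tower_rep_def by (elim conjE)
  then show "m < n \<Longrightarrow> B n \<subset> B m" by simp
qed

lemma B_antimono: "m \<le> n \<Longrightarrow> B n \<subseteq> B m"
  using B_strict by (cases "m = n") (auto simp: le_less)

lemma B_nonempty: "B n \<noteq> {}"
  using B_strict[of n "Suc n"] by auto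

lemma B_clopen: "open (B n)" "closed (B n)"
proof -
  have "\<forall>n. open (B n) \<and> closed (B n)"
    using rep unfolding tower_rep_def by (elim conjE)
  then show "open (B n)" "closed (B n)" by simp_all
qed

lemma h_strict: "strict_mono h"
  using rep unfolding tower_rep_def by (elim conjE)

lemma h_pos: "0 < h n"
proof -
  have "\<forall>n. 0 < h n"
    using rep unfolding tower_rep_def by (elim conjE)
  then show ?thesis by simp
qed

lemma levels_disjoint: "i < h n \<Longrightarrow> j < h n \<Longrightarrow> i \<noteq> j \<Longrightarrow> (f ^^ i) ` B n \<inter> (f ^^ j) ` B n = {}"
proof -
  have "\<forall>n. disjoint_family_on (\<lambda>i. (f ^^ i) ` B n) {..<h n}"
    using rep unfolding tower_rep_def by (elim conjE)
  then show "i < h n \<Longrightarrow> j < h n \<Longrightarrow> i \<noteq> j \<Longrightarrow> (f ^^ i) ` B n \<inter> (f ^^ j) ` B n = {}"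
    unfolding disjoint_family_on_def by blast
qed

lemma tower_mono: "m \<le> n \<Longrightarrow> tower f B h m \<subseteq> tower f B h n"
proof -
  have "\<forall>n. tower f B h n \<subseteq> tower f B h (Suc n)"
    using rep unfolding tower_rep_def by (elim conjE)
  then show "m \<le> n \<Longrightarrow> tower f B h m \<subseteq> tower f B h n"
    using lift_Suc_mono_le[of "tower f B h" m n] by blast
qed

lemma basis:
  "topological_basis ({zpow f k ` B n | k n. True} \<union> {zpow f k ` leftover f B h n | k n. True})"
  using rep unfolding tower_rep_def by (elim conjE)

lemma mem_tower: "x \<in> tower f B h n \<longleftrightarrow> (\<exists>j<h n. zpow f (- int j) x \<in> B n)"
  unfolding tower_def zpow_of_nat[symmetric] by (auto simp: mem_image simp del: of_nat_less_iff)

lemma no_early_return: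
  assumes "x \<in> B n" "0 < k" "k < int (h n)"
  shows "zpow f k x \<notin> B n"
proof
  assume k: "zpow f k x \<in> B n"
  have "zpow f k x = (f ^^ nat k) x" using assms(2) by (simp add: zpow_def)
  then have "zpow f k x \<in> (f ^^ nat k) ` B n" using assms(1) by simp
  moreover have "zpow f k x \<in> (f ^^ 0) ` B n" using k by simp
  moreover have "nat k < h n" "nat k \<noteq> 0" using assms(2,3) by linarith+
  ultimately show False using levels_disjoint[OF _ h_pos[of n], of "nat k"] by blast
qed

lemma base_subset_tower: "B n \<subseteq> tower f B h n"
proof
  fix x assume "x \<in> B n"
  then have "zpow f (- int 0) x \<in> B n" by simp
  then show "x \<in> tower f B h n" unfolding mem_tower using h_pos by blast
qed

lemma level_base_cases:
  assumes nN: "n \<le> N" and i: "i < h N" and x: "x \<in> B N" "(f ^^ i) x \<in> B n"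
  shows "i \<in> offsets f B h n N"
proof -
  have x': "(f ^^ i) x \<in> (f ^^ i) ` B N" using x(1) by simp
  have "(f ^^ i) x \<in> tower f B h n" using x(2) base_subset_tower by blast
  then have "(f ^^ i) ` B N \<inter> tower f B h n \<noteq> {}" using x' by blast
  from tower_rep_level[OF rep nN i this]
  obtain j where j: "j < h n" "(f ^^ i) ` B N \<subseteq> (f ^^ j) ` B n" by blast
  have "j = 0"
  proof (rule ccontr)
    assume "j \<noteq> 0"
    then have "(f ^^ j) ` B n \<inter> (f ^^ 0) ` B n = {}"
      using levels_disjoint[OF j(1) h_pos] by simp
    then show False using j(2) x' x(2) by auto
  qed
  then show ?thesis using j(2) i by (simp add: offsets_def)
qed

text \<open>A visit to \<open>B n\<close> happens inside the \<open>N\<close>-th tower, because the towers increase; the level at which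
  it happens is contained in \<open>B n\<close>, and going down to the base leads to a visit to \<open>B N\<close>.\<close>

lemma visits_decompose:
  assumes nN: "n \<le> N"
  shows "visits f (B n) x = {e + int d |e d. e \<in> visits f (B N) x \<and> d \<in> offsets f B h n N}"
proof (intro equalityI subsetI)
  fix k assume "k \<in> visits f (B n) x"
  then have k: "zpow f k x \<in> B n" by (simp add: visits_def)
  then have "zpow f k x \<in> tower f B h n" using base_subset_tower by blast
  then obtain j where j: "j < h N" "zpow f (- int j) (zpow f k x) \<in> B N"
    using tower_mono[OF nN] unfolding mem_tower[of _ N] subset_iff by blast
  define e where "e = k - int j"
  have "k = int j + e" by (simp add: e_def)
  have e: "zpow f e x \<in> B N" using j(2) zpow_add[OF bij, of "- int j" k x] by (simp add: e_def)
  have "zpow f k x = (f ^^ j) (zpow f e x)"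
    using zpow_add[OF bij, of "int j" e x] \<open>k = int j + e\<close> by (simp add: zpow_of_nat)
  then have "j \<in> offsets f B h n N" using level_base_cases[OF nN j(1) e] k by simp
  then show "k \<in> {e + int d |e d. e \<in> visits f (B N) x \<and> d \<in> offsets f B h n N}"
    using e by (force simp: visits_def e_def)
next
  fix k assume "k \<in> {e + int d |e d. e \<in> visits f (B N) x \<and> d \<in> offsets f B h n N}"
  then obtain e d where k: "k = e + int d" "zpow f e x \<in> B N" "d \<in> offsets f B h n N"
    by (auto simp: visits_def)
  have "zpow f k x = (f ^^ d) (zpow f e x)"
    using zpow_add[OF bij, of "int d" e x] k(1) by (simp add: zpow_of_nat add.commute)
  then show "k \<in> visits f (B n) x"
    using k(2,3) by (auto simp: visits_def offsets_def)
qed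

lemma visits_separated:
  assumes "k \<in> visits f (B n) x" "k' \<in> visits f (B n) x" "k < k'"
  shows "k + int (h n) \<le> k'"
proof (rule ccontr)
  assume "\<not> k + int (h n) \<le> k'"
  then have "zpow f (k' - k) (zpow f k x) \<notin> B n"
    using assms by (intro no_early_return) (auto simp: visits_def)
  then show False using zpow_add[OF bij, of "k' - k" k x] assms(2) by (simp add: visits_def)
qed

lemma block_sequence_visits:
  assumes "\<And>n c. \<exists>k\<in>visits f (B n) x. c \<le> k"
  shows "block_sequence h (offsets f B h) (\<lambda>n. visits f (B n) x)"
proof
  show "visits f (B n) x = {e + int d |e d. e \<in> visits f (B N) x \<and> d \<in> offsets f B h n N}"
    if "n \<le> N" for n N using that by (rule visits_decompose)
  show "k + int (h n) \<le> k'"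
    if "k \<in> visits f (B n) x" "k' \<in> visits f (B n) x" "k < k'" for k k' n
    using that by (rule visits_separated)
  show "\<exists>k\<in>visits f (B n) x. c \<le> k" for n c by (rule assms)
  show "offsets f B h m N \<subseteq> offsets f B h n N" if "n \<le> m" for n m N
    using B_antimono[OF that] by (auto simp: offsets_def)
  show "0 \<in> offsets f B h n N" if "n \<le> N" for n N
    using B_antimono[OF that] h_pos by (simp add: offsets_def)
qed (auto simp: offsets_def h_pos)

text \<open>Each step adds an offset: a point of \<open>B N - B (Suc N)\<close> lies on a level of the next tower which
  is not the base, is contained in \<open>B N\<close>, and has height at least \<open>h N\<close>.\<close>

lemma card_offsets_ge: "k < card (offsets f B h n (n + k))"
proof (induction k)
  case 0
  have "0 \<in> offsets f B h n n" using h_pos by (simp add: offsets_def)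
  moreover have "finite (offsets f B h n n)" by (simp add: offsets_def)
  ultimately have "0 < card (offsets f B h n n)" by (metis card_gt_0_iff empty_iff)
  then show ?case by simp
next
  case (Suc k)
  define N where "N = n + k"
  have nN: "n \<le> N" by (simp add: N_def)
  obtain z where z: "z \<in> B N" "z \<notin> B (Suc N)" using B_strict[of N "Suc N"] by auto
  have "z \<in> tower f B h (Suc N)" using z(1) base_subset_tower tower_mono[of N "Suc N"] by auto
  then obtain j where j: "j < h (Suc N)" "z \<in> (f ^^ j) ` B (Suc N)" unfolding tower_def by blast
  then obtain w where w: "z = (f ^^ j) w" "w \<in> B (Suc N)" by blast
  have "j \<in> offsets f B h N (Suc N)" using level_base_cases[OF _ j(1) w(2)] z(1) w(1) by simp
  then have j_new: "j \<in> offsets f B h n (Suc N)" using B_antimono[OF nN] by (auto simp: offsets_def)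
  have "h N \<le> j"
  proof (rule ccontr)
    assume "\<not> h N \<le> j"
    moreover have "j \<noteq> 0" using z w by (cases j) auto
    moreover have "w \<in> B N" using w(2) B_strict[of N "Suc N"] by auto
    ultimately have "zpow f (int j) w \<notin> B N" by (intro no_early_return) auto
    then show False using z(1) w(1) by (simp add: zpow_of_nat)
  qed
  then have "j \<notin> offsets f B h n N" by (simp add: offsets_def)
  moreover have "h N < h (Suc N)" using h_strict by (simp add: strict_mono_Suc_iff)
  then have "offsets f B h n N \<subseteq> offsets f B h n (Suc N)"
    using B_antimono[of N "Suc N"] by (auto simp: offsets_def image_subset_iff)
  ultimately have "offsets f B h n N \<subset> offsets f B h n (Suc N)" using j_new by blast
  moreover have "finite (offsets f B h n (Suc N))" by (simp add: offsets_def)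
  ultimately have "card (offsets f B h n N) < card (offsets f B h n (Suc N))" by (rule psubset_card_mono[rotated])
  then show ?case using Suc by (simp add: N_def)
qed

lemma many_offsets: "\<exists>N\<ge>K. n \<le> N \<and> C < card (offsets f B h n N)"
proof (intro exI conjI)
  show "C < card (offsets f B h n (n + (C + K)))" using card_offsets_ge[of "C + K" n] by simp
qed auto

lemma large_offset: "\<exists>N\<ge>n. \<exists>d\<in>offsets f B h n N. K \<le> d"
proof -
  have "\<not> offsets f B h n (n + K) \<subseteq> {..<K}"
    using card_offsets_ge[of K n] card_mono[of "{..<K}" "offsets f B h n (n + K)"] by auto
  then show ?thesis by (meson le_add1 lessThan_iff not_le subsetI)
qed

text \<open>The infinite word is the itinerary of any point of \<open>B n\<close> with respect to the tower of level \<open>0\<close>,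
  for the first \<open>h n\<close> steps.\<close>

lemma infinite_word_base:
  assumes w: "w \<in> B n" and i: "i < h n"
  shows "infinite_word f B h i = 0 \<longleftrightarrow> (f ^^ i) w \<in> tower f B h 0"
proof -
  have "infinite_word f B h i = 0 \<longleftrightarrow> (\<exists>j<h 0. (f ^^ i) ` B n \<subseteq> (f ^^ j) ` B 0)"
    using infinite_word_eq[OF rep i] by (simp add: tower_word_def)
  also have "\<dots> \<longleftrightarrow> (f ^^ i) w \<in> tower f B h 0"
  proof
    assume "(f ^^ i) w \<in> tower f B h 0"
    then have "(f ^^ i) ` B n \<inter> tower f B h 0 \<noteq> {}" using w by blast
    then show "\<exists>j<h 0. (f ^^ i) ` B n \<subseteq> (f ^^ j) ` B 0"
      by (intro tower_rep_level[OF rep _ i]) auto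
  next
    assume "\<exists>j<h 0. (f ^^ i) ` B n \<subseteq> (f ^^ j) ` B 0"
    then show "(f ^^ i) w \<in> tower f B h 0" using w unfolding tower_def by blast
  qed
  finally show ?thesis .
qed

lemma infinite_word_le_1: "infinite_word f B h i \<in> {0, 1}"
  by (simp add: infinite_word_def tower_word_def)

end

section \<open>Levels in open sets, recurrence and aperiodicity\<close>

locale nonrepeating_tower = rank_one_tower +
  assumes nonrep: "non_repeating f B h"
begin

lemma period_broken:
  assumes "1 \<le> p"
  shows "\<exists>i n. i + p < h n \<and>
    (\<forall>w\<in>B n. (f ^^ i) w \<in> tower f B h 0 \<longleftrightarrow> (f ^^ (i + p)) w \<notin> tower f B h 0)"
proof -
  obtain i where i: "infinite_word f B h (i + p) \<noteq> infinite_word f B h i"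
    using nonrep assms unfolding non_repeating_def by blast
  define n where "n = Suc (i + p)"
  have "n \<le> h n" using h_strict by (rule strict_mono_imp_increasing)
  then have n: "i + p < h n" by (simp add: n_def)
  show ?thesis
  proof (intro exI conjI ballI)
    show "i + p < h n" by (rule n)
    fix w assume w: "w \<in> B n"
    have "infinite_word f B h i = 0 \<longleftrightarrow> (f ^^ i) w \<in> tower f B h 0"
      "infinite_word f B h (i + p) = 0 \<longleftrightarrow> (f ^^ (i + p)) w \<in> tower f B h 0"
      using infinite_word_base[OF w, of i] infinite_word_base[OF w n] n by simp_all
    then show "(f ^^ i) w \<in> tower f B h 0 \<longleftrightarrow> (f ^^ (i + p)) w \<notin> tower f B h 0"
      using i infinite_word_le_1[of i] infinite_word_le_1[of "i + p"] by auto
  qed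
qed

text \<open>If every level of every tower met the tower of level \<open>n\<close>, then an orbit starting in \<open>B N\<close> would
  stay in that tower for \<open>h N\<close> steps, so it would return to \<open>B n\<close> exactly every \<open>h n\<close> steps. The
  infinite word would be the repetition of its first \<open>h n\<close> letters.\<close>

lemma leftover_contains_level:
  "\<exists>N i. i < h N \<and> (f ^^ i) ` B N \<subseteq> leftover f B h n"
proof (rule ccontr)
  assume none: "\<nexists>N i. i < h N \<and> (f ^^ i) ` B N \<subseteq> leftover f B h n"
  define p where "p = h n"
  have p: "0 < p" using h_pos by (simp add: p_def)
  obtain i N' where i: "i + p < h N'"
    and broken: "\<forall>w\<in>B N'. (f ^^ i) w \<in> tower f B h 0 \<longleftrightarrow> (f ^^ (i + p)) w \<notin> tower f B h 0"
    using period_broken[of p] p by auto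
  define N where "N = max n N'"
  have N: "n \<le> N" "N' \<le> N" by (simp_all add: N_def)
  obtain w where w: "w \<in> B N" using B_nonempty by blast
  have hN: "h N' \<le> h N" using N(2) h_strict by (simp add: strict_mono_less_eq)
  have in_tower: "(f ^^ t) w \<in> tower f B h n" if "t < h N" for t
  proof -
    have "(f ^^ t) ` B N \<inter> tower f B h n \<noteq> {}"
      using none that unfolding leftover_def by blast
    from tower_rep_level[OF rep N(1) that this] show ?thesis using w unfolding tower_def by blast
  qed
  have base: "(f ^^ (q * p)) w \<in> B n" if "q * p < h N" for q
    using that
  proof (induction q)
    case 0
    then show ?case using w B_antimono[OF N(1)] by auto
  next
    case (Suc q)
    then have IH: "(f ^^ (q * p)) w \<in> B n" by simp
    obtain j where j: "j < p" "zpow f (- int j) ((f ^^ (Suc q * p)) w) \<in> B n"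
      using in_tower[OF Suc.prems] unfolding mem_tower p_def by blast
    have "int (Suc q * p) - int j \<in> visits f (B n) w"
      using j(2) zpow_add[OF bij, of "- int j" "int (Suc q * p)" w]
      by (simp add: visits_def zpow_of_nat[symmetric] del: of_nat_mult of_nat_Suc mult_Suc)
    moreover have "int (q * p) \<in> visits f (B n) w" using IH by (simp only: mem_visits zpow_of_nat)
    moreover have "int (q * p) < int (Suc q * p) - int j" using j(1) by simp
    ultimately have "int (q * p) + int p \<le> int (Suc q * p) - int j"
      using visits_separated[of "int (q * p)" n w] unfolding p_def by blast
    then have "j = 0" by simp
    then show ?case using j(2) by simp
  qed
  have word: "(f ^^ (q * p + s)) w \<in> tower f B h 0 \<longleftrightarrow> infinite_word f B h s = 0"
    if "q * p + s < h N" "s < p" for q s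
  proof -
    have "(f ^^ (q * p)) w \<in> B n" using that by (intro base) simp
    from infinite_word_base[OF this, of s] show ?thesis
      using that(2) by (simp add: p_def funpow_add add.commute[of _ s])
  qed
  have "i = (i div p) * p + i mod p" "i + p = Suc (i div p) * p + i mod p" by simp_all
  then have "(f ^^ i) w \<in> tower f B h 0 \<longleftrightarrow> (f ^^ (i + p)) w \<in> tower f B h 0"
    using word[of "i div p" "i mod p"] word[of "Suc (i div p)" "i mod p"] i hN p
    by (metis add_lessD1 less_le_trans mod_less_divisor)
  then show False using broken w B_antimono[OF N(2)] by blast
qed

lemma open_contains_level:
  assumes "open V" "V \<noteq> {}"
  obtains a m where "zpow f a ` B m \<subseteq> V"
proof -
  obtain x where "x \<in> V" using assms(2) by blast
  then obtain V' where V': "V' \<subseteq> V"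
    and "V' \<in> {zpow f k ` B n | k n. True} \<union> {zpow f k ` leftover f B h n | k n. True}"
    by (rule topological_basisE[OF basis assms(1)])
  from this(2) obtain k n where "V' = zpow f k ` B n \<or> V' = zpow f k ` leftover f B h n"
    by blast
  then show ?thesis
  proof
    assume "V' = zpow f k ` B n"
    then show ?thesis using that[of k n] V' by simp
  next
    assume V'_eq: "V' = zpow f k ` leftover f B h n"
    obtain N i where i: "(f ^^ i) ` B N \<subseteq> leftover f B h n" using leftover_contains_level by blast
    have "zpow f (k + int i) ` B N \<subseteq> V"
    proof
      fix y assume "y \<in> zpow f (k + int i) ` B N"
      then obtain w where w: "w \<in> B N" "y = zpow f (k + int i) w" by blast
      then have "y = zpow f k ((f ^^ i) w)" using zpow_add[OF bij, of k "int i"] by (simp add: zpow_of_nat)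
      then show "y \<in> V" using w(1) i V' V'_eq by blast
    qed
    then show ?thesis by (rule that)
  qed
qed

lemma visit_enters:
  assumes "zpow f a ` B m \<subseteq> V" "k \<in> visits f (B m) x"
  shows "zpow f (k + a) x \<in> V"
proof -
  have "zpow f (k + a) x = zpow f a (zpow f k x)"
    using zpow_add[OF bij, of a k x] by (simp add: add.commute)
  moreover have "zpow f k x \<in> B m" using assms(2) by (simp add: visits_def)
  ultimately show ?thesis using assms(1) by auto
qed

text \<open>Baire: visiting \<open>B n\<close> after time \<open>c\<close> is an open condition, and it is dense since every
  level \<open>f\<^sup>a (B m)\<close> contains levels of higher towers, from which the orbit meets \<open>B n\<close> arbitrarily late.\<close>

lemma exists_recurrent_point: "\<exists>x. \<forall>n c. \<exists>k\<in>visits f (B n) x. c \<le> k"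
proof -
  define U where "U = (\<lambda>(n, c). \<Union>k\<in>{int c..}. zpow f k -` B n)"
  have U_open: "open (U nc)" for nc
    unfolding U_def case_prod_unfold
    by (intro open_UN ballI open_vimage B_clopen continuous_on_zpow homeo)
  have U_dense: "closure (U nc) = UNIV" for nc
  proof -
    obtain n c where nc: "nc = (n, c)" by fastforce
    have meets: "U nc \<inter> V \<noteq> {}" if V0: "open V" "V \<noteq> {}" for V
    proof -
      obtain a m where V: "zpow f a ` B m \<subseteq> V" using open_contains_level[OF V0] by blast
      obtain N d where N: "max m n \<le> N" and d: "d \<in> offsets f B h (max m n) N" "nat (int c + a) \<le> d"
        using large_offset[of "max m n" "nat (int c + a)"] by blast
      obtain w where w: "w \<in> B N" using B_nonempty by blast
      have "w \<in> B m" using w N B_antimono[of m N] by auto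
      then have "zpow f a w \<in> V" using V by blast
      moreover have "zpow f (int d - a) (zpow f a w) = (f ^^ d) w"
        using zpow_add[OF bij, of "int d - a" a w] by (simp add: zpow_of_nat)
      then have "zpow f (int d - a) (zpow f a w) \<in> B n"
        using d(1) w B_antimono[of n "max m n"] by (auto simp: offsets_def)
      then have "zpow f a w \<in> U nc" using d(2) by (auto simp: U_def nc)
      ultimately show ?thesis by blast
    qed
    have "U nc \<inter> - closure (U nc) = {}" using closure_subset by blast
    then show ?thesis using meets[of "- closure (U nc)"] by auto
  qed
  have "Met_TC.mtopology closure_of (\<Inter>(range U)) = (UNIV :: 'a set)"
    by (rule Met_TC.metric_Baire_category) (auto simp: U_open U_dense)
  then have "\<Inter>(range U) \<noteq> {}" by auto
  then obtain x where x: "x \<in> U nc" for nc by auto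
  have "\<exists>k\<in>visits f (B n) x. c \<le> k" for n c
  proof -
    obtain k where "int (nat c) \<le> k" "zpow f k x \<in> B n" using x[of "(n, nat c)"] by (auto simp: U_def)
    moreover from this have "c \<le> k" by linarith
    ultimately have "k \<in> visits f (B n) x" "c \<le> k" by (simp_all add: visits_def)
    then show ?thesis by blast
  qed
  then show ?thesis by blast
qed

text \<open>What continuity of \<open>g\<close> gives: the open set \<open>g -` B n\<close> contains a level, so some visits of the orbit
  of \<open>g x\<close> to \<open>B n\<close> are predicted by visits of the orbit of \<open>x\<close> to a smaller base.\<close>

lemma commuting_code:
  assumes g: "homeo g" "g \<circ> f = f \<circ> g"
  shows "\<exists>m a. \<forall>x. \<forall>k\<in>visits f (B m) x. k + a \<in> visits f (B n) (g x)"
proof -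
  have "open (g -` B n)" using homeo_continuous(1)[OF g(1)] B_clopen(1) by (rule open_vimage[rotated])
  moreover have "g -` B n \<noteq> {}"
    using B_nonempty[of n] bij_is_surj[OF homeo_bij[OF g(1)]] by (metis ex_in_conv surjD vimageI)
  ultimately obtain a m where V: "zpow f a ` B m \<subseteq> g -` B n"
    using open_contains_level by blast
  have "k + a \<in> visits f (B n) (g x)" if "k \<in> visits f (B m) x" for x k
  proof -
    have "zpow f (k + a) x \<in> g -` B n"
      using V that by (rule visit_enters)
    then show ?thesis by (simp add: visits_def zpow_commute[OF bij g(2)])
  qed
  then show ?thesis by blast
qed

text \<open>The tower of level \<open>0\<close> is built from translates of \<open>B 0\<close>, so a period of the visits to \<open>B 0\<close> from
  some time on is a period of the itinerary from then on. But at every visit to \<open>B n\<close>, however late,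
  the orbit reads the first \<open>h n\<close> letters of the infinite word, where the period breaks if \<open>n\<close> is large.\<close>

lemma visits_0_aperiodic:
  assumes unb: "\<And>n c. \<exists>k\<in>visits f (B n) x. c \<le> k" and p: "0 < p"
  shows "\<exists>k\<ge>c. \<not> (k \<in> visits f (B 0) x \<longleftrightarrow> k + p \<in> visits f (B 0) x)"
proof (rule ccontr)
  assume "\<not> ?thesis"
  then have per: "k \<in> visits f (B 0) x \<longleftrightarrow> k + p \<in> visits f (B 0) x" if "c \<le> k" for k
    using that by blast
  have "1 \<le> nat p" using p by simp
  from period_broken[OF this] obtain i n where i: "\<forall>w\<in>B n.
      (f ^^ i) w \<in> tower f B h 0 \<longleftrightarrow> (f ^^ (i + nat p)) w \<notin> tower f B h 0"
    by blast
  obtain k where k: "k \<in> visits f (B n) x" "c + int (h 0) \<le> k" using unb by blast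
  have tower_iff: "(f ^^ t) (zpow f k x) \<in> tower f B h 0 \<longleftrightarrow> (\<exists>j<h 0. k + int t - int j \<in> visits f (B 0) x)" for t
  proof -
    have "zpow f (- int j) ((f ^^ t) (zpow f k x)) = zpow f (k + int t - int j) x" for j
    proof -
      have "(f ^^ t) (zpow f k x) = zpow f (int t + k) x"
        using zpow_add[OF bij, of "int t" k x] by (simp add: zpow_of_nat)
      then show ?thesis using zpow_add[OF bij, of "- int j" "int t + k" x] by (simp add: algebra_simps)
    qed
    then show ?thesis unfolding mem_tower mem_visits by simp
  qed
  have "k + int i - int j \<in> visits f (B 0) x \<longleftrightarrow> k + int (i + nat p) - int j \<in> visits f (B 0) x"
    if "j < h 0" for j
    using per[of "k + int i - int j"] that k(2) p by (simp add: algebra_simps)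
  then have "(f ^^ i) (zpow f k x) \<in> tower f B h 0 \<longleftrightarrow> (f ^^ (i + nat p)) (zpow f k x) \<in> tower f B h 0"
    unfolding tower_iff by blast
  moreover have "zpow f k x \<in> B n" using k(1) by (simp add: visits_def)
  ultimately show False using i by blast
qed

section \<open>The centralizer\<close>

lemma basis_closed:
  assumes "V \<in> {zpow f k ` B n | k n. True} \<union> {zpow f k ` leftover f B h n | k n. True}"
  shows "closed V"
proof -
  have "open (tower f B h n)" for n
  proof -
    have "tower f B h n = (\<Union>j<h n. zpow f (- int j) -` B n)" by (auto simp: mem_tower)
    also have "open \<dots>" by (intro open_UN ballI open_vimage B_clopen continuous_on_zpow homeo)
    finally show ?thesis .
  qed
  then have "closed (leftover f B h n)" for n by (simp add: leftover_def closed_def)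
  moreover have "zpow f k ` A = zpow f (- k) -` A" for k A
    by (intro set_eqI) (simp only: mem_image vimage_eq)
  ultimately have "closed (zpow f k ` B n)" "closed (zpow f k ` leftover f B h n)" for k n
    using B_clopen(2) continuous_on_zpow[OF homeo] by (simp_all add: closed_vimage)
  then show ?thesis using assms by auto
qed

text \<open>With \<open>\<delta>\<close> from \<open>uniform_translation\<close>, the map \<open>\<tau> = f\<^sup>\<delta> \<circ> g\<close> sends \<open>x\<close> to a point whose orbit
  eventually visits each basic set at the same times as the orbit of \<open>x\<close>. If a basic, hence clopen, set
  \<open>V\<close> separated \<open>x\<close> from \<open>\<tau> x\<close>, then so it would \<open>f\<^sup>k x\<close> from \<open>f\<^sup>k (\<tau> x)\<close> whenever \<open>f\<^sup>k x\<close> is near \<open>x\<close>,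
  which recurs at arbitrarily late times \<open>k\<close>. So \<open>\<tau>\<close> fixes \<open>x\<close>, and with it the dense orbit of \<open>x\<close>.\<close>

theorem commuting_homeo_is_power:
  assumes g: "homeo g" "g \<circ> f = f \<circ> g"
  shows "\<exists>i. zpow f i = g"
proof -
  obtain x where x: "\<And>n c. \<exists>k\<in>visits f (B n) x. c \<le> k" using exists_recurrent_point by blast
  define E where "E = (\<lambda>n. visits f (B n) x)"
  define F where "F = (\<lambda>n. visits f (B n) (g x))"
  have bij_g: "bij g" using g(1) by (rule homeo_bij)
  have "homeomorphism UNIV UNIV (inv g) g"
    using g(1) unfolding homeo_def by (subst homeomorphism_sym)
  then have "homeo (inv g)" by (simp add: homeo_def inv_inv_eq[OF bij_g])
  moreover have "inv g \<circ> f = f \<circ> inv g"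
  proof
    fix z
    have "g (f (inv g z)) = f z" 
      using fun_cong[OF g(2), of "inv g z"] bij_g by (simp add: bij_is_surj surj_f_inv_f)
    then show "(inv g \<circ> f) z = (f \<circ> inv g) z"
      using inv_f_f[OF bij_is_inj[OF bij_g], of "f (inv g z)"] by simp
  qed
  ultimately have code_inv: "\<exists>m a. \<forall>y. \<forall>k\<in>visits f (B m) y. k + a \<in> visits f (B n) (inv g y)" for n
    by (rule commuting_code)
  have EF: "\<exists>m a. \<forall>k\<in>E m. k + a \<in> F n" for n
    using commuting_code[OF g, of n] unfolding E_def F_def by blast
  have FE: "\<exists>m b. \<forall>k\<in>F m. k + b \<in> E n" for n
  proof -
    obtain m b where "\<forall>y. \<forall>k\<in>visits f (B m) y. k + b \<in> visits f (B n) (inv g y)"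
      using code_inv by blast
    then have "\<forall>k\<in>F m. k + b \<in> visits f (B n) (inv g (g x))" unfolding F_def by blast
    moreover have "inv g (g x) = x" using bij_g by (simp add: bij_is_inj)
    ultimately show ?thesis unfolding E_def by auto
  qed
  have y: "\<exists>k\<in>F n. c \<le> k" for n c
  proof -
    obtain m a where a: "\<forall>k\<in>E m. k + a \<in> F n" using EF by blast
    obtain k where "k \<in> E m" "c - a \<le> k" using x unfolding E_def by blast
    then have "k + a \<in> F n" "c \<le> k + a" using a by auto
    then show ?thesis by blast
  qed
  interpret block_sequence_pair h "offsets f B h" E F
    unfolding E_def F_def block_sequence_pair_def
    by (intro conjI block_sequence_visits x y[unfolded F_def])
  have "\<exists>\<delta>. \<forall>n. \<exists>c. \<forall>k\<ge>c. k \<in> E n \<longleftrightarrow> k + \<delta> \<in> F n"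
  proof (rule uniform_translation[OF EF FE many_offsets])
    show "\<exists>k\<ge>c. \<not> (k \<in> E 0 \<longleftrightarrow> k + p \<in> E 0)" if "0 < p" for p c
      using visits_0_aperiodic[OF x that] unfolding E_def .
  qed
  then obtain \<delta> where \<delta>: "\<And>n. \<exists>c. \<forall>k\<ge>c. k \<in> E n \<longleftrightarrow> k + \<delta> \<in> F n" by blast
  define \<tau> where "\<tau> z = zpow f \<delta> (g z)" for z
  have \<tau>_commute: "\<tau> (zpow f k z) = zpow f k (\<tau> z)" for k z
    using zpow_add[OF bij, of \<delta> k "g z"] zpow_add[OF bij, of k \<delta> "g z"]
    unfolding \<tau>_def zpow_commute[OF bij g(2)] by (simp add: add.commute)
  have \<tau>_cont: "continuous_on UNIV \<tau>"
    unfolding \<tau>_def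
    by (rule continuous_on_compose2[OF continuous_on_zpow[OF homeo, of UNIV] homeo_continuous(1)[OF g(1)]]) simp
  have agree: "\<exists>c. \<forall>k\<ge>c. zpow f k x \<in> V \<longleftrightarrow> zpow f k (\<tau> x) \<in> V"
    if V: "V \<in> {zpow f k ` B n | k n. True} \<union> {zpow f k ` leftover f B h n | k n. True}" for V
  proof -
    have shifted: "zpow f k (\<tau> x) \<in> B n \<longleftrightarrow> k + \<delta> \<in> F n" for k n
      using zpow_add[OF bij, of k \<delta> "g x"] by (simp add: \<tau>_def F_def visits_def)
    have plain: "zpow f k x \<in> B n \<longleftrightarrow> k \<in> E n" for k n by (simp add: E_def visits_def)
    have sub: "zpow f (- b) (zpow f k z) = zpow f (k - b) z" for b k z
      using zpow_add[OF bij, of "- b" k z] by simp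
    obtain b n where "V = zpow f b ` B n \<or> V = zpow f b ` leftover f B h n" using V by blast
    moreover obtain c where c: "\<forall>k\<ge>c. k \<in> E n \<longleftrightarrow> k + \<delta> \<in> F n" using \<delta> by blast
    have "zpow f k x \<in> zpow f b ` B n \<longleftrightarrow> zpow f k (\<tau> x) \<in> zpow f b ` B n" if "c + b \<le> k" for k
      using c that unfolding mem_image sub shifted plain by simp
    moreover have "zpow f k x \<in> zpow f b ` leftover f B h n \<longleftrightarrow> zpow f k (\<tau> x) \<in> zpow f b ` leftover f B h n"
      if "c + b + int (h n) \<le> k" for k
      using c that unfolding mem_image sub leftover_def Compl_iff mem_tower shifted plain by simp
    ultimately show ?thesis by blast
  qed
  have "\<tau> x = x"
  proof (rule ccontr)
    assume "\<tau> x \<noteq> x"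
    then have x_in: "x \<in> - {\<tau> x}" by simp
    have "open (- {\<tau> x})" by (simp add: open_Compl)
    from basis this x_in
    obtain V where V: "V \<in> {zpow f k ` B n | k n. True} \<union> {zpow f k ` leftover f B h n | k n. True}"
      "x \<in> V" "V \<subseteq> - {\<tau> x}"
      by (rule topological_basisE)
    define W where "W = V \<inter> \<tau> -` (- V)"
    have "open W" unfolding W_def
      using topological_basis_open[OF basis V(1)] basis_closed[OF V(1)] \<tau>_cont
      by (intro open_Int open_vimage) auto
    moreover have "x \<in> W" using V(2,3) by (auto simp: W_def)
    ultimately obtain a m where W: "zpow f a ` B m \<subseteq> W" using open_contains_level by blast
    obtain c where c: "\<forall>k\<ge>c. zpow f k x \<in> V \<longleftrightarrow> zpow f k (\<tau> x) \<in> V" using agree[OF V(1)] by blast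
    obtain k where k: "k \<in> visits f (B m) x" "c - a \<le> k" using x by blast
    have "zpow f (k + a) x \<in> W" using W k(1) by (rule visit_enters)
    then have "zpow f (k + a) x \<in> V" "zpow f (k + a) (\<tau> x) \<notin> V"
      by (simp_all add: W_def \<tau>_commute)
    then show False using c[rule_format, of "k + a"] k(2) by simp
  qed
  have "\<tau> z = z" for z
  proof (rule ccontr)
    assume "\<tau> z \<noteq> z"
    moreover have "open {z. \<tau> z \<noteq> z}"
      by (intro open_Collect_neq \<tau>_cont continuous_on_id)
    ultimately obtain a m where W: "zpow f a ` B m \<subseteq> {z. \<tau> z \<noteq> z}" using open_contains_level by blast
    obtain k where k: "k \<in> visits f (B m) x" using x by blast
    then have "zpow f (k + a) x \<in> {z. \<tau> z \<noteq> z}" by (rule visit_enters[OF W])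
    then show False by (simp add: \<tau>_commute \<open>\<tau> x = x\<close>)
  qed
  then have "zpow f (- \<delta>) z = g z" for z
    using zpow_add[OF bij, of "- \<delta>" \<delta> "g z"] by (simp add: \<tau>_def)
  then show ?thesis by blast
qed

end

theorem theorem2p1:
  fixes f g :: "'a::polish_space \<Rightarrow> 'a"
  assumes "rank_1 f"
    and "\<exists>B h. tower_rep f B h \<and> non_repeating f B h"
    and "homeo g"
    and "g \<circ> f = f \<circ> g"
  shows "\<exists>i::int. zpow f i = g"
proof -
  obtain B h where "tower_rep f B h" "non_repeating f B h" using assms(2) by blast
  then interpret nonrepeating_tower f B h
    using assms(1) by unfold_locales (simp_all add: rank_1_def)
  show ?thesis using assms(3,4) by (rule commuting_homeo_is_power)
qed

end
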